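(* Let $n=4m+2$ for some $m\in\mathbb{N}\cup\{0\}$. Then $$Z_{\sqrt2}h_n(\tfrac p4,\tfrac12)=2^{1/4}\sum_{k\in\mathbb{Z}}(-1)^k h_n\bigl(\sqrt2\,(k+\tfrac p4)\bigr)=0\quad\text{for } p\in\{1,3\},$$ and $$Z_{\sqrt3}h_n(\tfrac p6,\tfrac12)=3^{1/4}\sum_{k\in\mathbb{Z}}(-1)^k h_n\bigl(\sqrt3\,(k+\tfrac p6)\bigr)=0\quad\text{for } p\in\{1,5\}.$$
   Context: The $n$th Hermite function is $h_n(x)=c_n^{-1/2}e^{\pi x^2}\frac{d^n}{dx^n}e^{-2\pi x^2}$ with $c_n=(2\pi)^n2^{n-1/2}n!$, $n\in\mathbb{N}\cup\{0\}$. For $\lambda>0$ the Zak transform is $Z_\lambda f(x,\gamma)=\sqrt\lambda\sum_{k\in\mathbb{Z}}f(\lambda(x+k))e^{-2\pi ik\gamma}$, $x,\gamma\in\mathbb{R}$; for $f=h_n$ the series converges absolutely for every $(x,\gamma)$ and the values are understood pointwise. *)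

theory Defs
  imports "HOL-Analysis.Analysis"
begin

definition hermite_const :: "nat \<Rightarrow> real" where
  "hermite_const n = (2 * pi) ^ n * 2 powr (real n - 1 / 2) * fact n"

definition hermite_fun :: "nat \<Rightarrow> real \<Rightarrow> real" where
  "hermite_fun n x =
     hermite_const n powr (- 1 / 2) * exp (pi * x\<^sup>2) *
     (deriv ^^ n) (\<lambda>t. exp (- 2 * pi * t\<^sup>2)) x"

(* infsum is unconditional summation, i.e. absolute convergence for complex-valued terms;
   it returns 0 when the family is not summable. *)
definition zak :: "real \<Rightarrow> (real \<Rightarrow> complex) \<Rightarrow> real \<Rightarrow> real \<Rightarrow> complex" where
  "zak l f x \<gamma> =
     complex_of_real (sqrt l) *
     (\<Sum>\<^sub>\<infinity>k::int. f (l * (x + of_int k)) *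
        exp (- 2 * complex_of_real pi * \<i> * of_int k * complex_of_real \<gamma>))"

end

theory Submission
  imports Defs "HOL-Probability.Characteristic_Functions"
    "HOL-Complex_Analysis.Cauchy_Integral_Formula"
begin

text \<open>
Write $x_0 = 1/(2N)$ and $b_k = \sqrt N (k + x_0)$ with $N \in \{2,3\}$. Since $h_n$ is even for even
\<open>n\<close>, the substitution $k \mapsto -1-k$ reduces the four sums to $S = \sum_k (-1)^k h_n(b_k)$.

The reason for the vanishing is Poisson summation. The Fourier transform sends $h_n$ to
$(-i)^n h_n = -h_n$, and the point $x_0$ is chosen so that the Poisson dual of \<open>S\<close> is a sum of $h_n$
over the same nodes with the same weights, up to the factor
$\frac{2}{\sqrt N}\cos\frac{\pi}{2N} = 1$. Therefore $S = -S$.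

The proof treats all \<open>n\<close> at once through the generating function
$G(z,x) = e^{-\pi x^2 - 4\pi x z - 2\pi z^2} = \sum_n \frac{z^n}{n!}\, e^{\pi x^2} \frac{d^n}{dx^n} e^{-2\pi x^2}$.
As $G(s,b_k) = e^{2\pi s^2} e^{-\pi N (k + x_0 + 2s/\sqrt N)^2}$, the Poisson formula for the Gaussian at
real points, \<open>alternating_gaussian_poisson\<close>, applies to $\Theta(z) = \sum_k (-1)^k G(z,b_k)$ for real
\<open>z\<close> and gives
$\Theta(s) + \Theta(-s) = \Theta(is) + \Theta(-is)$ for real \<open>s\<close> (\<open>hermite_gen_sum_rotation\<close>, with
the arithmetic of the weights in \<open>dual_sum_fold\<close>). The coefficient of $s^n$ in this identity is a
nonzero multiple of \<open>S\<close> when $n \equiv 2 \pmod 4$, once the summations over \<open>k\<close> and \<open>n\<close> are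
interchanged (\<open>hermite_sum_generating_function\<close>).

The Gaussian Poisson formula itself is proved by comparing cosine coefficients on $[0,1]$: both sides
are antiperiodic, and a continuous function on $[0,1]$ orthogonal to all $\cos j\pi x$ vanishes.
\<close>

section \<open>Gaussian majorants for series over the integers\<close>

lemma summable_on_int_exp: "(\<lambda>k::int. exp (- \<bar>of_int k\<bar>) :: real) summable_on UNIV"
proof -
  have nat: "(\<lambda>n::nat. exp (- real n)) summable_on UNIV"
  proof -
    have "summable (\<lambda>n. exp (-1 :: real) ^ n)"
      by (rule summable_geometric) simp
    moreover have "exp (-1 :: real) ^ n = exp (- real n)" for n
      by (simp flip: exp_of_nat_mult)
    ultimately have "summable (\<lambda>n::nat. exp (- real n))" by simp
    then show ?thesis
      by (intro norm_summable_imp_summable_on) simp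
  qed
  have pos: "(\<lambda>k::int. exp (- \<bar>of_int k\<bar>) :: real) summable_on (range int)"
    using nat by (subst summable_on_reindex) (auto simp: o_def)
  have neg: "(\<lambda>k::int. exp (- \<bar>of_int k\<bar>) :: real) summable_on (range (\<lambda>n. - int n))"
    using nat by (subst summable_on_reindex) (auto simp: o_def inj_on_def)
  have "(UNIV :: int set) = range int \<union> range (\<lambda>n. - int n)"
    by (auto intro: int_cases2)
  then show ?thesis using pos neg
    by (metis summable_on_union)
qed

text \<open>Completing the square turns the Gaussian decay into a geometric bound in $k$ that is uniform for
\<open>x\<close> in a bounded set; it serves as the majorant of every series over the integers below.\<close>

lemma gaussian_le_exp_abs:
  fixes A c X x :: real and k :: int
  assumes "A > 0" "\<bar>x\<bar> \<le> X"
  shows "exp (- A * (of_int k + x)\<^sup>2 + c * \<bar>of_int k + x\<bar>)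
           \<le> exp ((c + 1)\<^sup>2 / (4 * A) + X) * exp (- \<bar>of_int k\<bar>)"
proof -
  define y where "y = \<bar>of_int k + x\<bar>"
  have y2: "(of_int k + x)\<^sup>2 = y\<^sup>2" by (simp add: y_def)
  have "0 \<le> (2 * A * y - (c + 1))\<^sup>2 / (4 * A)" using assms by simp
  also have "\<dots> = A * y\<^sup>2 - (c + 1) * y + (c + 1)\<^sup>2 / (4 * A)"
    using assms by (simp add: power2_eq_square field_simps)
  finally have "- A * y\<^sup>2 + c * y \<le> (c + 1)\<^sup>2 / (4 * A) - y" by (simp add: algebra_simps)
  moreover have "\<bar>of_int k\<bar> - X \<le> y" using assms(2) unfolding y_def by linarith
  ultimately show ?thesis
    unfolding y2 y_def[symmetric] by (simp flip: exp_add)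
qed

lemma summable_on_gaussian:
  fixes A c x :: real
  assumes "A > 0"
  shows "(\<lambda>k::int. exp (- A * (of_int k + x)\<^sup>2 + c * \<bar>of_int k + x\<bar>)) summable_on UNIV"
  by (rule summable_on_comparison_test
        [OF summable_on_cmult_right[OF summable_on_int_exp] gaussian_le_exp_abs[OF assms order_refl]])
     auto

section \<open>Completeness of the cosines on the unit interval\<close>

text \<open>Multiplication by $\cos \pi x$ maps $\cos j\pi x$ to the average of its two neighbours
$\cos (j \pm 1)\pi x$, so orthogonality to all cosines survives it.\<close>

lemma cos_power_orthogonal:
  fixes F :: "real \<Rightarrow> real"
  assumes cont: "continuous_on {0..1} F"
    and orth: "\<And>j::int. integral {0..1} (\<lambda>x. F x * cos (of_int j * pi * x)) = 0"
  shows "integral {0..1} (\<lambda>x. F x * cos (pi * x) ^ i * cos (of_int j * pi * x)) = 0"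
proof (induction i arbitrary: j)
  case 0
  then show ?case using orth by simp
next
  case (Suc i)
  have int: "(\<lambda>x. F x * cos (pi * x) ^ i * cos (of_int j * pi * x)) integrable_on {0..1}" for j :: int
    by (intro integrable_continuous_interval continuous_intros cont)
  have eq: "F x * cos (pi * x) ^ Suc i * cos (of_int j * pi * x) =
      1 / 2 * (F x * cos (pi * x) ^ i * cos (of_int (j + 1) * pi * x))
      + 1 / 2 * (F x * cos (pi * x) ^ i * cos (of_int (j - 1) * pi * x))" for x
    by (simp add: algebra_simps cos_add cos_diff)
  have "integral {0..1} (\<lambda>x. F x * cos (pi * x) ^ Suc i * cos (of_int j * pi * x)) =
      1 / 2 * integral {0..1} (\<lambda>x. F x * cos (pi * x) ^ i * cos (of_int (j + 1) * pi * x))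
      + 1 / 2 * integral {0..1} (\<lambda>x. F x * cos (pi * x) ^ i * cos (of_int (j - 1) * pi * x))"
    unfolding eq
    by (subst integral_add) (use int in \<open>auto intro!: integrable_on_cmult_left simp del: of_int_add of_int_diff\<close>)
  then show ?case by (simp add: Suc.IH del: of_int_add of_int_diff)
qed

text \<open>On $[0,1]$ every continuous function is a continuous function of $u = \cos \pi x$, so Weierstrass
approximation by polynomials in $u$ makes \<open>F\<close> a uniform limit of functions orthogonal to it. Hence
$\int F^2 = 0$.\<close>

lemma cosine_coeffs_zero_imp_zero:
  fixes F :: "real \<Rightarrow> real"
  assumes cont: "continuous_on {0..1} F"
    and orth: "\<And>j::int. integral {0..1} (\<lambda>x. F x * cos (of_int j * pi * x)) = 0"
    and x: "x \<in> {0..1}"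
  shows "F x = 0"
proof -
  define G where "G u = F (arccos u / pi)" for u
  have contG: "continuous_on {-1..1} G"
    unfolding G_def
    by (intro continuous_on_compose2[OF cont] continuous_intros)
       (auto simp: field_simps arccos_lbound arccos_ubound)
  have G_cos: "G (cos (pi * x)) = F x" if "x \<in> {0..1}" for x
    using that by (simp add: G_def arccos_cos)
  have F2: "(\<lambda>x. F x * F x) integrable_on {0..1}" and Fabs: "(\<lambda>x. \<bar>F x\<bar>) integrable_on {0..1}"
    by (intro integrable_continuous_interval continuous_intros cont)+
  define M where "M = integral {0..1} (\<lambda>x. \<bar>F x\<bar>)"
  have M: "M \<ge> 0" unfolding M_def by (intro integral_nonneg Fabs) auto
  \<comment> \<open>A polynomial \<open>p\<close> with $|G - p| < e$ gives $\int F^2 = \int F\,(F - p(\cos \pi x)) \le e M$.\<close>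
  have le: "integral {0..1} (\<lambda>x. F x * F x) \<le> e * M" if "e > 0" for e
  proof -
    obtain p where p: "real_polynomial_function p" "\<And>u. u \<in> {-1..1} \<Longrightarrow> \<bar>G u - p u\<bar> < e"
      by (rule Stone_Weierstrass_real_polynomial_function[OF compact_Icc contG \<open>e > 0\<close>, of thesis]) blast
    obtain a n where pa: "p = (\<lambda>x. \<Sum>i\<le>n. a i * x ^ i)"
      using p(1) real_polynomial_function_iff_sum by blast
    have ip: "(\<lambda>x. F x * p (cos (pi * x))) integrable_on {0..1}"
      unfolding pa by (intro integrable_continuous_interval continuous_intros cont)
    have "integral {0..1} (\<lambda>x. F x * p (cos (pi * x)))
        = integral {0..1} (\<lambda>x. \<Sum>i\<le>n. a i * (F x * cos (pi * x) ^ i * cos (of_int 0 * pi * x)))"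
      unfolding pa by (simp add: sum_distrib_left algebra_simps)
    also have "\<dots> = (\<Sum>i\<le>n. a i * integral {0..1} (\<lambda>x. F x * cos (pi * x) ^ i * cos (of_int 0 * pi * x)))"
      by (subst integral_sum) (auto intro!: integrable_continuous_interval continuous_intros cont)
    also have "\<dots> = 0" by (subst cos_power_orthogonal[OF cont orth]) simp
    finally have 0: "integral {0..1} (\<lambda>x. F x * p (cos (pi * x))) = 0" .
    have "integral {0..1} (\<lambda>x. F x * F x) = integral {0..1} (\<lambda>x. F x * F x - F x * p (cos (pi * x)))"
      by (subst integral_diff[OF F2 ip]) (simp add: 0)
    also have "\<dots> \<le> integral {0..1} (\<lambda>x. e * \<bar>F x\<bar>)"
    proof (rule integral_le)
      show "(\<lambda>x. F x * F x - F x * p (cos (pi * x))) integrable_on {0..1}"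
        by (intro integrable_diff F2 ip)
      show "(\<lambda>x. e * \<bar>F x\<bar>) integrable_on {0..1}"
        by (intro integrable_continuous_interval continuous_intros cont)
      fix x :: real assume x: "x \<in> {0..1}"
      have "\<bar>F x - p (cos (pi * x))\<bar> < e"
        using p(2)[of "cos (pi * x)"] G_cos[OF x] by simp
      then have "\<bar>F x * (F x - p (cos (pi * x)))\<bar> \<le> \<bar>F x\<bar> * e"
        unfolding abs_mult by (intro mult_left_mono) auto
      then show "F x * F x - F x * p (cos (pi * x)) \<le> e * \<bar>F x\<bar>"
        by (simp add: algebra_simps abs_le_iff)
    qed
    also have "\<dots> = e * M" by (simp add: M_def)
    finally show ?thesis .
  qed
  have "integral {0..1} (\<lambda>x. F x * F x) \<le> 0"
  proof (rule field_le_epsilon)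
    fix e :: real assume "e > 0"
    then have "integral {0..1} (\<lambda>x. F x * F x) \<le> e / (M + 1) * M" using le[of "e / (M + 1)"] M by simp
    also have "\<dots> \<le> e" using M \<open>e > 0\<close> by (simp add: field_simps)
    finally show "integral {0..1} (\<lambda>x. F x * F x) \<le> 0 + e" by simp
  qed
  moreover have "integral {0..1} (\<lambda>x. F x * F x) \<ge> 0" by (intro integral_nonneg F2) auto
  ultimately have "((\<lambda>x. F x * F x) has_integral 0) (cbox 0 1)"
    using F2 by (metis integrable_integral interval_cbox order_antisym)
  then have "F x * F x = 0"
    by (rule has_integral_0_cbox_imp_0[rotated 2]) (use x in \<open>auto intro!: continuous_intros cont\<close>)
  then show ?thesis by simp
qed

section \<open>Poisson summation for the alternating Gaussian sum\<close>

lemma termwise_integration: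
  fixes f :: "'a \<Rightarrow> real \<Rightarrow> real"
  assumes bound: "\<And>k x. x \<in> {a..b} \<Longrightarrow> \<bar>f k x\<bar> \<le> M k"
    and M: "M summable_on UNIV"
    and cont: "\<And>k. continuous_on {a..b} (f k)"
  shows "continuous_on {a..b} (\<lambda>x. \<Sum>\<^sub>\<infinity>k. f k x)"
    and "((\<lambda>k. integral {a..b} (f k)) has_sum integral {a..b} (\<lambda>x. \<Sum>\<^sub>\<infinity>k. f k x)) UNIV"
proof -
  have unif: "uniform_limit {a..b} (\<lambda>X x. \<Sum>k\<in>X. f k x) (\<lambda>x. \<Sum>\<^sub>\<infinity>k. f k x)
      (finite_subsets_at_top UNIV)"
    by (rule Weierstrass_m_test_general[OF _ M]) (use bound in simp)
  have contX: "continuous_on {a..b} (\<lambda>x. \<Sum>k\<in>X. f k x)" for X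
    by (intro continuous_intros cont)
  show "continuous_on {a..b} (\<lambda>x. \<Sum>\<^sub>\<infinity>k. f k x)"
    by (rule uniform_limit_theorem[OF _ unif]) (use contX in simp_all)
  obtain I J where I: "\<And>X. ((\<lambda>x. \<Sum>k\<in>X. f k x) has_integral I X) {a..b}"
    and J: "((\<lambda>x. \<Sum>\<^sub>\<infinity>k. f k x) has_integral J) {a..b}"
    and lim: "(I \<longlongrightarrow> J) (finite_subsets_at_top UNIV)"
    by (rule uniform_limit_integral[OF unif contX finite_subsets_at_top_neq_bot]) blast
  have "I X = (\<Sum>k\<in>X. integral {a..b} (f k))" if "finite X" for X
  proof -
    have "I X = integral {a..b} (\<lambda>x. \<Sum>k\<in>X. f k x)"
      by (rule integral_unique[OF I, symmetric])
    also have "\<dots> = (\<Sum>k\<in>X. integral {a..b} (f k))"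
      by (rule integral_sum[OF that]) (intro integrable_continuous_interval cont)
    finally show ?thesis .
  qed
  then have "eventually (\<lambda>X. I X = (\<Sum>k\<in>X. integral {a..b} (f k))) (finite_subsets_at_top UNIV)"
    by (intro eventually_finite_subsets_at_top_weakI) auto
  from Lim_transform_eventually[OF lim this]
  show "((\<lambda>k. integral {a..b} (f k)) has_sum integral {a..b} (\<lambda>x. \<Sum>\<^sub>\<infinity>k. f k x)) UNIV"
    using J by (simp add: has_sum_def integral_unique)
qed

text \<open>This is the unfolding step of Poisson summation: the integrals over the unit intervals
$[k, k+1]$ add up to the integral over the line.\<close>

lemma has_sum_unit_intervals:
  fixes g :: "real \<Rightarrow> real"
  assumes cont: "continuous_on UNIV g" and int: "integrable lborel g"
    and sum: "((\<lambda>k::int. integral {0..1} (\<lambda>x. g (x + of_int k))) has_sum S) UNIV"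
  shows "S = (LINT x|lborel. g x)"
proof -
  have gint: "g integrable_on {a..b}" for a b
    by (intro integrable_continuous_interval continuous_on_subset[OF cont]) auto
  have part: "(\<Sum>k\<in>{- int n..<int n}. integral {0..1} (\<lambda>x. g (x + of_int k)))
      = integral {- real n..real n} g" for n
  proof (induction n)
    case (Suc n)
    have shift: "integral {0..1} (\<lambda>x. g (x + c)) = integral {c..c + 1} g" for c
      using integral_shift_Icc_real[of 0 1 g c] by (simp add: add.commute o_def)
    have "{- int (Suc n)..<int (Suc n)} = insert (- int (Suc n)) (insert (int n) {- int n..<int n})"
      by auto
    then have "(\<Sum>k\<in>{- int (Suc n)..<int (Suc n)}. integral {0..1} (\<lambda>x. g (x + of_int k)))
        = integral {- real (Suc n)..- real n} g
          + (integral {real n..real (Suc n)} g + integral {- real n..real n} g)"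
      using Suc.IH by (simp add: shift add.commute)
    also have "\<dots> = integral {- real (Suc n)..real (Suc n)} g"
      using Henstock_Kurzweil_Integration.integral_combine[OF _ _ gint, of "- real (Suc n)" "- real n" "real (Suc n)"]
        Henstock_Kurzweil_Integration.integral_combine[OF _ _ gint, of "- real n" "real n" "real (Suc n)"] by simp
    finally show ?case .
  qed simp
  have "filterlim (\<lambda>n. {- int n..<int n}) (finite_subsets_at_top UNIV) sequentially"
    unfolding filterlim_finite_subsets_at_top
  proof safe
    fix X :: "int set" assume X: "finite X"
    obtain B where B: "\<And>k. k \<in> X \<Longrightarrow> \<bar>k\<bar> \<le> B"
      using X by (metis finite_imageI finite_nat_set_iff_bounded_le Max_ge image_eqI)
    show "\<forall>\<^sub>F n in sequentially. finite {- int n..<int n} \<and> X \<subseteq> {- int n..<int n} \<and> {- int n..<int n} \<subseteq> UNIV"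
      using eventually_gt_at_top[of "nat B"]
    proof eventually_elim
      case (elim n)
      then show ?case using B by (force simp: abs_le_iff)
    qed
  qed
  from filterlim_compose[OF sum[unfolded has_sum_def] this]
  have lim1: "(\<lambda>n. integral {- real n..real n} g) \<longlonglongrightarrow> S"
    by (simp add: part)
  have "(\<lambda>n. LINT x|lborel. indicator {- real n..real n} x *\<^sub>R g x) \<longlonglongrightarrow> (LINT x|lborel. g x)"
  proof (rule integral_dominated_convergence)
    show "integrable lborel (\<lambda>x. norm (g x))" using int by simp
    show "AE x in lborel. (\<lambda>n. indicator {- real n..real n} x *\<^sub>R g x) \<longlonglongrightarrow> g x"
    proof (rule AE_I2, rule tendsto_eventually)
      fix x :: real
      show "\<forall>\<^sub>F n in sequentially. indicator {- real n..real n} x *\<^sub>R g x = g x"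
        using eventually_ge_at_top[of "nat \<lceil>\<bar>x\<bar>\<rceil>"]
      proof eventually_elim
        case (elim n)
        then have "x \<in> {- real n..real n}" by (auto simp: nat_ceiling_le_eq)
        then show ?case by simp
      qed
    qed
  qed (use int in \<open>auto split: split_indicator\<close>)
  moreover have "(LINT x|lborel. indicator {- real n..real n} x *\<^sub>R g x) = integral {- real n..real n} g" for n
  proof -
    have "set_integrable lborel {- real n..real n} g"
      unfolding set_integrable_def using int by (intro integrable_mult_indicator) auto
    from set_borel_integral_eq_integral(2)[OF this] show ?thesis
      by (simp add: set_lebesgue_integral_def)
  qed
  ultimately show ?thesis using lim1 LIMSEQ_unique by simp
qed

text \<open>The substitution $x \mapsto \sqrt{2\pi A}\, x$ turns the integrand into the standard normal density
times a cosine, and the integral into the real part of the characteristic function of the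
normal distribution.\<close>

lemma gaussian_cosine_transform:
  fixes A t :: real
  assumes "A > 0"
  shows "integrable lborel (\<lambda>x. exp (- (pi * A * x\<^sup>2)) * cos (pi * t * x))"
    and "(LINT x|lborel. exp (- (pi * A * x\<^sup>2)) * cos (pi * t * x)) = exp (- (pi * t\<^sup>2 / (4 * A))) / sqrt A"
proof -
  define c where "c = sqrt (2 * pi * A)"
  define s where "s = pi * t / c"
  have c: "c > 0" "c\<^sup>2 = 2 * pi * A" using assms by (simp_all add: c_def)
  have sq: "c / sqrt (2 * pi) = sqrt A" using assms by (simp add: c_def real_sqrt_mult)
  interpret real_distribution std_normal_distribution by (rule real_dist_normal_dist)
  have int1: "integrable std_normal_distribution (\<lambda>x. iexp (s * x))"
    by (rule integrable_iexp) auto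
  then have int: "integrable std_normal_distribution (\<lambda>x. cos (s * x))"
    using integrable_Re[OF int1] by (simp add: Re_exp)
  have "(LINT x|std_normal_distribution. cos (s * x)) = Re (char std_normal_distribution s)"
    unfolding char_def by (subst integral_Re[OF int1, symmetric]) (simp add: Re_exp)
  also have "\<dots> = exp (- (s\<^sup>2) / 2)"
    unfolding char_std_normal_distribution by simp
  finally have val: "(LINT x|lborel. std_normal_density x * cos (s * x)) = exp (- (s\<^sup>2) / 2)"
    by (subst (asm) integral_density) (auto)
  have int': "integrable lborel (\<lambda>x. std_normal_density x * cos (s * x))"
    using int by (subst (asm) integrable_density) auto
  have sub: "std_normal_density (0 + c * x) * cos (s * (0 + c * x))
      = 1 / sqrt (2 * pi) * (exp (- (pi * A * x\<^sup>2)) * cos (pi * t * x))" for x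
    using c by (simp add: std_normal_density_def s_def power_mult_distrib mult.assoc)
  have "integrable lborel (\<lambda>x. std_normal_density (0 + c * x) * cos (s * (0 + c * x)))"
    by (rule lborel_integrable_real_affine[OF int']) (use c in simp)
  from integrable_mult_right[OF this[unfolded sub], of "sqrt (2 * pi)"]
  show "integrable lborel (\<lambda>x. exp (- (pi * A * x\<^sup>2)) * cos (pi * t * x))"
    by simp
  have "exp (- (s\<^sup>2) / 2) = c * (1 / sqrt (2 * pi) * (LINT x|lborel. exp (- (pi * A * x\<^sup>2)) * cos (pi * t * x)))"
    unfolding val[symmetric] using c
    by (subst lborel_integral_real_affine[where c = c and t = 0]) (simp_all only: sub, simp_all)
  also have "\<dots> = sqrt A * (LINT x|lborel. exp (- (pi * A * x\<^sup>2)) * cos (pi * t * x))"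
    by (simp flip: sq)
  also have "s\<^sup>2 / 2 = pi * t\<^sup>2 / (4 * A)"
    using c(1) assms by (simp add: s_def power_divide power_mult_distrib c(2)) (simp add: power2_eq_square field_simps)
  then have "- (s\<^sup>2) / 2 = - (pi * t\<^sup>2 / (4 * A))" by simp
  finally show "(LINT x|lborel. exp (- (pi * A * x\<^sup>2)) * cos (pi * t * x)) = exp (- (pi * t\<^sup>2 / (4 * A))) / sqrt A"
    using assms by (simp add: field_simps)
qed

lemma integral_cos_int_pi:
  "integral {0..1} (\<lambda>x. cos (of_int m * pi * x)) = (if m = 0 then 1 else 0)"
proof (cases "m = 0")
  case False
  have "((\<lambda>x. cos (of_int m * pi * x)) has_integral
      (sin (of_int m * pi * 1) / (of_int m * pi) - sin (of_int m * pi * 0) / (of_int m * pi))) {0..1}"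
    by (rule fundamental_theorem_of_calculus)
       (use False in \<open>auto intro!: derivative_eq_intros simp flip: has_real_derivative_iff_has_vector_derivative\<close>)
  moreover have "sin (of_int m * pi) = 0" using sin_times_pi_eq_0 by simp
  ultimately show ?thesis using False by (simp add: integral_unique)
qed simp

lemma alternating_gaussian_sum_shift:
  fixes A x :: real
  shows "(\<Sum>\<^sub>\<infinity>k::int. (- 1) powi k * exp (- (pi * A * (of_int k + (x + 1))\<^sup>2)))
       = - (\<Sum>\<^sub>\<infinity>k::int. (- 1) powi k * exp (- (pi * A * (of_int k + x)\<^sup>2)))"
proof -
  have "bij (\<lambda>k::int. k + 1)" by (rule bij_betwI[where g = "\<lambda>k. k - 1"]) auto
  from infsum_reindex_bij_betw[OF this, of "\<lambda>k. (- 1) powi k * exp (- (pi * A * (of_int k + x)\<^sup>2))"]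
  have "(\<Sum>\<^sub>\<infinity>k::int. (- 1) powi k * exp (- (pi * A * (of_int k + x)\<^sup>2)))
      = (\<Sum>\<^sub>\<infinity>k::int. - ((- 1) powi k * exp (- (pi * A * (of_int k + (x + 1))\<^sup>2))))"
    by (simp add: power_int_add algebra_simps)
  then show ?thesis by (simp add: infsum_uminus)
qed

lemma alternating_gaussian_sum_minus:
  fixes A x :: real
  shows "(\<Sum>\<^sub>\<infinity>k::int. (- 1) powi k * exp (- (pi * A * (of_int k + - x)\<^sup>2)))
       = (\<Sum>\<^sub>\<infinity>k::int. (- 1) powi k * exp (- (pi * A * (of_int k + x)\<^sup>2)))"
proof -
  have "(of_int (- k) + x)\<^sup>2 = (of_int k + - x)\<^sup>2" for k :: int
    by (simp add: power2_eq_square algebra_simps)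
  with infsum_reindex_bij_betw[OF bij_uminus, of "\<lambda>k. (- 1) powi k * exp (- (pi * A * (of_int k + x)\<^sup>2))"]
  show ?thesis by (simp only: power_int_minus_one_minus)
qed

text \<open>For odd \<open>J\<close> the alternating sign is absorbed by
$\cos J\pi(x+k) = (-1)^k \cos J\pi x$, so that the integral over $[0,1]$ unfolds to a Gaussian
integral over the line. For even \<open>J\<close> the reflection $x \mapsto 1 - x$ preserves the cosine
and changes the sign of the sum.\<close>

lemma alternating_gaussian_sum_cosine_coeff:
  fixes A :: real and J :: int
  assumes "A > 0"
  defines "L \<equiv> \<lambda>x. \<Sum>\<^sub>\<infinity>k::int. (- 1) powi k * exp (- (pi * A * (of_int k + x)\<^sup>2))"
  shows "continuous_on {0..1} L"
    and "integral {0..1} (\<lambda>x. L x * cos (of_int J * pi * x))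
      = (if even J then 0 else exp (- (pi * (of_int J)\<^sup>2 / (4 * A))) / sqrt A)"
proof -
  define M where "M k = exp (1 / (4 * (pi * A)) + 1) * exp (- \<bar>of_int k :: real\<bar>)" for k :: int
  have M: "M summable_on UNIV"
    unfolding M_def by (intro summable_on_cmult_right summable_on_int_exp)
  have le: "exp (- (pi * A * (of_int k + x)\<^sup>2)) \<le> M k" if "x \<in> {0..1}" for k x
    using gaussian_le_exp_abs[of "pi * A" x 1 k 0] that assms by (simp add: M_def)
  show contL: "continuous_on {0..1} L"
    unfolding L_def
    by (rule termwise_integration[OF _ M])
       (use le in \<open>auto simp: abs_mult power_int_abs intro!: continuous_intros\<close>)
  show "integral {0..1} (\<lambda>x. L x * cos (of_int J * pi * x))
      = (if even J then 0 else exp (- (pi * (of_int J)\<^sup>2 / (4 * A))) / sqrt A)"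
  proof (cases "even J")
    case True
    have "L (1 - x) = - L x" for x
      using alternating_gaussian_sum_shift[of A "- x"] alternating_gaussian_sum_minus[of A x]
      by (simp add: L_def)
    moreover have "cos (of_int J * pi * (1 - x)) = cos (of_int J * pi * x)" for x
      using True by (auto elim!: evenE simp: algebra_simps cos_diff)
    ultimately have "integral {0..1} (\<lambda>x. L x * cos (of_int J * pi * x))
        = - integral {0..1} (\<lambda>x. L (1 - x) * cos (of_int J * pi * (1 - x)))"
      by simp
    also have "integral {0..1} (\<lambda>x. L (1 - x) * cos (of_int J * pi * (1 - x)))
        = integral {0..1} (\<lambda>x. L x * cos (of_int J * pi * x))"
      using Henstock_Kurzweil_Integration.integral_reflect_real[of 0 "-1" "\<lambda>x. L (1 + x) * cos (of_int J * pi * (1 + x))"]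
        integral_shift_Icc_real[of "-1" 0 "\<lambda>x. L x * cos (of_int J * pi * x)" 1]
      by (simp add: o_def)
    finally show ?thesis using True by simp
  next
    case False
    define g where "g y = exp (- (pi * A * y\<^sup>2)) * cos (pi * of_int J * y)" for y :: real
    define f where "f k x = (- 1) powi k * exp (- (pi * A * (of_int k + x)\<^sup>2)) * cos (of_int J * pi * x)"
      for k :: int and x :: real
    have fg: "f k x = g (x + of_int k)" for k x
    proof -
      have "cos (pi * of_int J * (x + of_int k)) = cos (pi * of_int (J * k) + of_int J * pi * x)"
        by (simp add: algebra_simps)
      also have "\<dots> = (- 1) powi k * cos (of_int J * pi * x)"
        using False by (simp only: cos_add cos_npi_int sin_npi_int) (simp add: power_int_minus_left)
      finally have "cos (pi * of_int J * (x + of_int k)) = (- 1) powi k * cos (of_int J * pi * x)" .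
      then show ?thesis by (simp add: f_def g_def algebra_simps)
    qed
    have f_le: "\<bar>f k x\<bar> \<le> M k" if "x \<in> {0..1}" for k x
    proof -
      have "\<bar>f k x\<bar> = exp (- (pi * A * (of_int k + x)\<^sup>2)) * \<bar>cos (of_int J * pi * x)\<bar>"
        by (simp add: f_def abs_mult power_int_abs)
      also have "\<dots> \<le> exp (- (pi * A * (of_int k + x)\<^sup>2)) * 1"
        by (intro mult_left_mono) auto
      finally show ?thesis using le[OF that, of k] by simp
    qed
    have "((\<lambda>k. integral {0..1} (f k)) has_sum integral {0..1} (\<lambda>x. \<Sum>\<^sub>\<infinity>k. f k x)) UNIV"
      by (rule termwise_integration[OF f_le M]) (auto simp: f_def intro!: continuous_intros)
    also have "(\<lambda>x. \<Sum>\<^sub>\<infinity>k. f k x) = (\<lambda>x. L x * cos (of_int J * pi * x))"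
      by (simp add: f_def L_def infsum_cmult_left')
    finally have "((\<lambda>k. integral {0..1} (\<lambda>x. g (x + of_int k)))
        has_sum integral {0..1} (\<lambda>x. L x * cos (of_int J * pi * x))) UNIV"
      by (simp add: fg)
    then have "integral {0..1} (\<lambda>x. L x * cos (of_int J * pi * x)) = (LINT y|lborel. g y)"
      by (rule has_sum_unit_intervals[rotated 2])
         (use gaussian_cosine_transform(1)[OF assms(1)] in \<open>auto simp: g_def intro!: continuous_intros\<close>)
    then show ?thesis
      using False gaussian_cosine_transform(2)[OF assms(1)] by (simp add: g_def)
  qed
qed

text \<open>Orthogonality of the cosines on $[0,1]$ leaves only the two summands with $2l + 1 = \pm J$, and none
when \<open>J\<close> is even.\<close>

lemma dual_gaussian_sum_cosine_coeff:
  fixes A :: real and J :: int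
  assumes "A > 0"
  defines "R \<equiv> \<lambda>x. \<Sum>\<^sub>\<infinity>l::int. exp (- (pi * (of_int l + 1 / 2)\<^sup>2 / A)) * cos (of_int (2 * l + 1) * pi * x)"
  shows "continuous_on {0..1} R"
    and "integral {0..1} (\<lambda>x. R x * cos (of_int J * pi * x))
      = (if even J then 0 else exp (- (pi * (of_int J)\<^sup>2 / (4 * A))))"
proof -
  define q where "q l = exp (- (pi * (of_int l + 1 / 2)\<^sup>2 / A))" for l :: int
  have q: "q summable_on UNIV"
    using summable_on_gaussian[of "pi / A" "1/2" 0] assms by (simp add: q_def[abs_def])
  have qpos: "q l > 0" for l by (simp add: q_def)
  show contR: "continuous_on {0..1} R"
    unfolding R_def
  proof (rule termwise_integration[OF _ q])
    show "\<bar>exp (- (pi * (of_int l + 1 / 2)\<^sup>2 / A)) * cos (of_int (2 * l + 1) * pi * x)\<bar> \<le> q l" for l x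
      using mult_left_mono[OF abs_cos_le_one, of "q l"] qpos[of l] by (simp add: abs_mult q_def)
  qed (intro continuous_intros)
  define f where "f l x = q l * cos (of_int (2 * l + 1) * pi * x) * cos (of_int J * pi * x)"
    for l :: int and x :: real
  have f_le: "\<bar>f l x\<bar> \<le> q l" for l x
  proof -
    have "\<bar>cos (of_int (2 * l + 1) * pi * x)\<bar> * \<bar>cos (of_int J * pi * x)\<bar> \<le> 1 * 1"
      by (intro mult_mono) auto
    then show ?thesis using mult_left_mono[of _ 1 "q l"] qpos[of l]
      by (simp add: f_def abs_mult mult.assoc)
  qed
  have "((\<lambda>l. integral {0..1} (f l)) has_sum integral {0..1} (\<lambda>x. \<Sum>\<^sub>\<infinity>l. f l x)) UNIV"
    by (rule termwise_integration[OF f_le q]) (auto simp: f_def intro!: continuous_intros)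
  also have "(\<lambda>x. \<Sum>\<^sub>\<infinity>l. f l x) = (\<lambda>x. R x * cos (of_int J * pi * x))"
    by (simp add: f_def R_def q_def infsum_cmult_left')
  finally have sum: "((\<lambda>l. integral {0..1} (f l))
      has_sum integral {0..1} (\<lambda>x. R x * cos (of_int J * pi * x))) UNIV" .
  have int_f: "integral {0..1} (f l) = q l / 2 * ((if 2 * l + 1 = J then 1 else 0) + (if 2 * l + 1 = - J then 1 else 0))" for l
  proof -
    have prod: "p * cos u * cos v = p / 2 * cos (u - v) + p / 2 * cos (u + v)" for p u v :: real
      by (simp add: cos_diff cos_add field_simps)
    have arg: "of_int (2 * l + 1 - J) * pi * x = of_int (2 * l + 1) * pi * x - of_int J * pi * x"
      "of_int (2 * l + 1 + J) * pi * x = of_int (2 * l + 1) * pi * x + of_int J * pi * x" for x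
      by (simp_all add: algebra_simps)
    have "f l = (\<lambda>x. q l / 2 * cos (of_int (2 * l + 1 - J) * pi * x) + q l / 2 * cos (of_int (2 * l + 1 + J) * pi * x))"
      unfolding fun_eq_iff f_def arg prod by simp
    moreover have "integral {0..1} (\<lambda>x. q l / 2 * cos (of_int (2 * l + 1 - J) * pi * x) + q l / 2 * cos (of_int (2 * l + 1 + J) * pi * x))
       = q l / 2 * integral {0..1} (\<lambda>x. cos (of_int (2 * l + 1 - J) * pi * x))
       + q l / 2 * integral {0..1} (\<lambda>x. cos (of_int (2 * l + 1 + J) * pi * x))"
      by (subst integral_add) (auto intro!: integrable_continuous_interval continuous_intros)
    ultimately show ?thesis unfolding integral_cos_int_pi
      by (simp add: algebra_simps eq_neg_iff_add_eq_0)
  qed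
  show "integral {0..1} (\<lambda>x. R x * cos (of_int J * pi * x))
      = (if even J then 0 else exp (- (pi * (of_int J)\<^sup>2 / (4 * A))))"
  proof (cases "even J")
    case True
    then have "integral {0..1} (f l) = 0" for l
      unfolding int_f by (auto elim!: evenE) presburger+
    then show ?thesis using has_sum_unique[OF sum has_sum_0] True by simp
  next
    case False
    then obtain i where i: "J = 2 * i + 1" by (elim oddE)
    have "((\<lambda>l. integral {0..1} (f l)) has_sum (\<Sum>l\<in>{i, - 1 - i}. integral {0..1} (f l))) {i, - 1 - i}"
      by (intro has_sum_finite) simp
    then have "((\<lambda>l. integral {0..1} (f l)) has_sum (\<Sum>l\<in>{i, - 1 - i}. integral {0..1} (f l))) UNIV"
      by (subst has_sum_cong_neutral[where T = "{i, - 1 - i}" and g = "\<lambda>l. integral {0..1} (f l)"])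
         (auto simp: int_f i)
    from has_sum_unique[OF sum this]
    have "integral {0..1} (\<lambda>x. R x * cos (of_int J * pi * x)) = (\<Sum>l\<in>{i, - 1 - i}. integral {0..1} (f l))" .
    also have "\<dots> = q i / 2 + q (- 1 - i) / 2"
    proof -
      have "i \<noteq> - 1 - i" by presburger
      then show ?thesis by (simp add: int_f i)
    qed
    also have "q (- 1 - i) = q i" unfolding q_def by (simp add: power2_eq_square algebra_simps)
    also have "q i / 2 + q i / 2 = exp (- (pi * (of_int J)\<^sup>2 / (4 * A)))"
      unfolding q_def i by (simp add: power2_eq_square field_simps)
    finally show ?thesis using False by simp
  qed
qed

text \<open>Poisson summation for the alternating Gaussian sum, a modular transformation of a Jacobi theta
function. Both sides have the same cosine coefficients on $[0,1]$, hence agree there, and both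
change sign under $x \mapsto x + 1$.\<close>

lemma alternating_gaussian_poisson:
  fixes A x :: real
  assumes "A > 0"
  shows "(\<Sum>\<^sub>\<infinity>k::int. (- 1) powi k * exp (- (pi * A * (of_int k + x)\<^sup>2)))
    = (\<Sum>\<^sub>\<infinity>l::int. exp (- (pi * (of_int l + 1 / 2)\<^sup>2 / A)) * cos (of_int (2 * l + 1) * pi * x)) / sqrt A"
proof -
  define L where "L x = (\<Sum>\<^sub>\<infinity>k::int. (- 1) powi k * exp (- (pi * A * (of_int k + x)\<^sup>2)))" for x
  define R where "R x = (\<Sum>\<^sub>\<infinity>l::int. exp (- (pi * (of_int l + 1 / 2)\<^sup>2 / A)) * cos (of_int (2 * l + 1) * pi * x))" for x
  note L = alternating_gaussian_sum_cosine_coeff[OF assms, folded L_def]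
  note R = dual_gaussian_sum_cosine_coeff[OF assms, folded R_def]
  define F where "F x = L x - R x / sqrt A" for x
  have contF: "continuous_on {0..1} F"
    unfolding F_def using assms by (intro continuous_intros L R) auto
  have F0: "F x = 0" if "x \<in> {0..1}" for x
  proof (rule cosine_coeffs_zero_imp_zero[OF contF _ that])
    fix J :: int
    have "integral {0..1} (\<lambda>x. F x * cos (of_int J * pi * x))
        = integral {0..1} (\<lambda>x. L x * cos (of_int J * pi * x) - (R x * cos (of_int J * pi * x)) / sqrt A)"
      by (simp add: F_def algebra_simps)
    also have "\<dots> = integral {0..1} (\<lambda>x. L x * cos (of_int J * pi * x))
        - integral {0..1} (\<lambda>x. R x * cos (of_int J * pi * x)) / sqrt A"
      using assms
      by (subst integral_diff)
         (auto intro!: integrable_continuous_interval continuous_intros L R)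
    also have "\<dots> = 0" unfolding L R by simp
    finally show "integral {0..1} (\<lambda>x. F x * cos (of_int J * pi * x)) = 0" .
  qed
  have F_shift: "F (x + 1) = - F x" for x
  proof -
    have "R (x + 1) = - R x"
    proof -
      have "cos (of_int (2 * l + 1) * pi * (x + 1)) = - cos (of_int (2 * l + 1) * pi * x)" for l :: int
      proof -
        have "cos (of_int (2 * l + 1) * pi * (x + 1)) = cos (of_int (2 * l + 1) * pi * x + pi * of_int (2 * l + 1))"
          by (simp add: algebra_simps)
        also have "\<dots> = - cos (of_int (2 * l + 1) * pi * x)"
          by (simp only: cos_add cos_npi_int sin_npi_int) simp
        finally show ?thesis .
      qed
      then show ?thesis unfolding R_def by (simp add: infsum_uminus)
    qed
    then show ?thesis
      using alternating_gaussian_sum_shift[of A x] by (simp add: F_def L_def)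
  qed
  have F_nat: "F (x + real n) = 0 \<longleftrightarrow> F x = 0" for x n
  proof (induction n)
    case (Suc n)
    have "x + real (Suc n) = (x + real n) + 1" by simp
    with Suc F_shift[of "x + real n"] show ?case by (simp only: neg_equal_0_iff_equal)
  qed simp
  \<comment> \<open>Antiperiodicity transports the vanishing from $[0,1]$ to the whole line.\<close>
  have "F (frac x) = 0" by (intro F0) (simp add: less_imp_le[OF frac_lt_1])
  then have "F x = 0"
    using F_nat[of "frac x" "nat \<lfloor>x\<rfloor>"] F_nat[of x "nat (- \<lfloor>x\<rfloor>)"]
    by (cases "\<lfloor>x\<rfloor> \<ge> 0") (simp_all add: frac_def)
  then show ?thesis by (simp add: F_def L_def R_def)
qed

section \<open>The generating function of the Hermite functions\<close>

text \<open>The Hermite functions are defined by real derivatives, while the power series expansion and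
Cauchy's estimates concern complex ones; this identifies the two.\<close>

lemma higher_deriv_of_real:
  fixes f :: "complex \<Rightarrow> complex" and g :: "real \<Rightarrow> real"
  assumes "f holomorphic_on UNIV" "\<And>x. f (of_real x) = of_real (g x)"
  shows "(deriv ^^ n) f (of_real x) = of_real ((deriv ^^ n) g x)"
  using assms
proof (induction n arbitrary: f g x)
  case (Suc n)
  have "deriv f (of_real x) = of_real (deriv g x)" for x
  proof -
    have "(f has_field_derivative deriv f (of_real x)) (at (of_real x))"
      using Suc.prems(1) by (simp add: holomorphic_derivI)
    then have "((\<lambda>x. f (of_real x)) has_vector_derivative deriv f (of_real x)) (at x)"
      by (rule has_vector_derivative_real_field)
    then have *: "((\<lambda>x. complex_of_real (g x)) has_vector_derivative deriv f (of_real x)) (at x)"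
      by (simp add: Suc.prems(2))
    then have "(g has_real_derivative Re (deriv f (of_real x))) (at x)"
      and "((\<lambda>_. 0) has_real_derivative Im (deriv f (of_real x))) (at x)"
      by (simp_all add: has_vector_derivative_complex_iff)
    then show ?thesis
      by (metis DERIV_imp_deriv DERIV_const DERIV_unique complex_of_real_def complex_surj)
  qed
  then have "(deriv ^^ n) (deriv f) (of_real x) = of_real ((deriv ^^ n) (deriv g) x)"
    using Suc.prems(1) by (intro Suc.IH holomorphic_deriv) auto
  then show ?case by (simp add: funpow_swap1)
qed simp

text \<open>The Hermite function without its normalising constant.\<close>

definition hermite_kernel :: "nat \<Rightarrow> real \<Rightarrow> real" where
  "hermite_kernel n x = exp (pi * x\<^sup>2) * (deriv ^^ n) (\<lambda>t. exp (- 2 * pi * t\<^sup>2)) x"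

text \<open>The exponential generating function $\sum_n \frac{z^n}{n!} e^{\pi x^2} \frac{d^n}{dx^n} e^{-2\pi x^2}$
in closed form; it equals $e^{2\pi z^2} e^{-\pi (x+2z)^2}$.\<close>

definition hermite_gen :: "complex \<Rightarrow> real \<Rightarrow> complex" where
  "hermite_gen z x = exp (- of_real pi * (of_real x)\<^sup>2 - 4 * of_real pi * of_real x * z - 2 * of_real pi * z\<^sup>2)"

lemma complex_gaussian_higher_deriv:
  "(deriv ^^ n) (\<lambda>w::complex. exp (- 2 * of_real pi * w\<^sup>2)) (of_real x)
     = of_real (exp (- (pi * x\<^sup>2)) * hermite_kernel n x)"
proof -
  have "(deriv ^^ n) (\<lambda>w::complex. exp (- 2 * of_real pi * w\<^sup>2)) (of_real x)
      = of_real ((deriv ^^ n) (\<lambda>t. exp (- 2 * pi * t\<^sup>2)) x)"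
    by (rule higher_deriv_of_real) (auto intro!: holomorphic_intros simp flip: exp_of_real)
  then show ?thesis by (simp add: hermite_kernel_def exp_minus)
qed

lemma hermite_gen_power_series:
  "(\<lambda>n. of_real (hermite_kernel n x / fact n) * z ^ n) sums hermite_gen z x"
proof -
  define f where "f = (\<lambda>w::complex. exp (- 2 * of_real pi * w\<^sup>2))"
  have "f holomorphic_on ball (of_real x) (norm z + 1)"
    unfolding f_def by (intro holomorphic_intros)
  then have "(\<lambda>n. (deriv ^^ n) f (of_real x) / fact n * (of_real x + z - of_real x) ^ n) sums f (of_real x + z)"
    by (rule holomorphic_power_series) (simp add: dist_norm)
  then have "(\<lambda>n. of_real (exp (pi * x\<^sup>2)) * (of_real (exp (- (pi * x\<^sup>2)) * hermite_kernel n x) / fact n * z ^ n))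
      sums (of_real (exp (pi * x\<^sup>2)) * f (of_real x + z))"
    by (intro sums_mult) (simp only: f_def complex_gaussian_higher_deriv add_diff_cancel_left')
  also have "of_real (exp (pi * x\<^sup>2)) * f (of_real x + z) = hermite_gen z x"
    by (simp add: f_def hermite_gen_def exp_of_real[symmetric] power2_eq_square algebra_simps flip: exp_add)
  also have "(\<lambda>n. of_real (exp (pi * x\<^sup>2)) * (of_real (exp (- (pi * x\<^sup>2)) * hermite_kernel n x) / fact n * z ^ n))
      = (\<lambda>n. of_real (hermite_kernel n x / fact n) * z ^ n)"
    by (simp add: fun_eq_iff exp_minus field_simps)
  finally show ?thesis .
qed

text \<open>Cauchy's estimate on the circle of radius \<open>r\<close> about \<open>x\<close>. The Gaussian factor in \<open>x\<close> survives, which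
makes all double series in \<open>n\<close> and the integer \<open>k\<close> below absolutely convergent.\<close>

lemma hermite_kernel_bound:
  assumes "r > 0"
  shows "\<bar>hermite_kernel n x\<bar> / fact n * r ^ n \<le> exp (- pi * x\<^sup>2 + 4 * pi * r * \<bar>x\<bar> + 2 * pi * r\<^sup>2)"
proof -
  define f where "f = (\<lambda>w::complex. exp (- 2 * of_real pi * w\<^sup>2))"
  define B where "B = exp (- 2 * pi * x\<^sup>2 + 4 * pi * r * \<bar>x\<bar> + 2 * pi * r\<^sup>2)"
  \<comment> \<open>On the circle $w = x + u$, $|u| = r$, the real part of $-2\pi w^2$ is at most $-2\pi x^2 + 4\pi r|x| + 2\pi r^2$.\<close>
  have "norm ((deriv ^^ n) f (of_real x)) \<le> fact n * B / r ^ n"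
  proof (rule Cauchy_inequality)
    show "f holomorphic_on ball (of_real x) r" unfolding f_def by (intro holomorphic_intros)
    show "continuous_on (cball (of_real x) r) f" unfolding f_def by (intro continuous_intros)
    fix w :: complex assume "norm (of_real x - w) = r"
    define u where "u = w - of_real x"
    have u: "norm u = r" "w = of_real x + u"
      using \<open>norm (of_real x - w) = r\<close> by (simp_all add: u_def norm_minus_commute)
    have 1: "- Re (u\<^sup>2) \<le> r\<^sup>2"
      using abs_Re_le_cmod[of "u\<^sup>2"] u by (simp add: norm_power)
    have "\<bar>x * Re u\<bar> \<le> \<bar>x\<bar> * r"
      unfolding abs_mult using abs_Re_le_cmod[of u] u by (intro mult_left_mono) auto
    then have 2: "- (x * Re u) \<le> r * \<bar>x\<bar>" by (simp add: abs_le_iff mult.commute)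
    have "Re (- 2 * of_real pi * w\<^sup>2) = 2 * pi * (- x\<^sup>2 + 2 * (- (x * Re u)) + - Re (u\<^sup>2))"
      by (simp add: u(2) power2_eq_square algebra_simps)
    also have "\<dots> \<le> 2 * pi * (- x\<^sup>2 + 2 * (r * \<bar>x\<bar>) + r\<^sup>2)"
      using 1 2 by (intro mult_left_mono add_mono) auto
    finally show "norm (f w) \<le> B" by (simp add: f_def B_def algebra_simps)
  qed (use assms in auto)
  then have "exp (- (pi * x\<^sup>2)) * \<bar>hermite_kernel n x\<bar> \<le> fact n * B / r ^ n"
    unfolding f_def complex_gaussian_higher_deriv norm_of_real by (simp add: abs_mult)
  then have "\<bar>hermite_kernel n x\<bar> / fact n * r ^ n \<le> exp (pi * x\<^sup>2) * B"
    using assms by (simp add: exp_minus field_simps)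
  also have "\<dots> = exp (- pi * x\<^sup>2 + 4 * pi * r * \<bar>x\<bar> + 2 * pi * r\<^sup>2)"
    by (simp add: B_def flip: exp_add)
  finally show ?thesis .
qed

text \<open>Summation over $k$ commutes with the generating series: by Cauchy's estimate with radius
$r > 2|z|$ the double series is dominated by a Gaussian in $k$ times $2^{-n}$.\<close>

lemma hermite_sum_generating_function:
  fixes c x :: real and z :: complex
  assumes c: "c > 0"
  defines "t \<equiv> \<lambda>n. \<Sum>\<^sub>\<infinity>k::int. (- 1) powi k * hermite_kernel n (c * (of_int k + x))"
  shows "(\<lambda>k::int. (- 1) powi k * hermite_kernel n (c * (of_int k + x))) summable_on UNIV"
    and "(\<lambda>k::int. (- 1) powi k * hermite_gen z (c * (of_int k + x))) summable_on UNIV"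
    and "(\<lambda>n. of_real (t n / fact n) * z ^ n) sums
           (\<Sum>\<^sub>\<infinity>k::int. (- 1) powi k * hermite_gen z (c * (of_int k + x)))"
proof -
  define b where "b k = c * (of_int k + x)" for k :: int
  define B where "B r k = exp (- pi * (b k)\<^sup>2 + 4 * pi * r * \<bar>b k\<bar> + 2 * pi * r\<^sup>2)" for r k
  have B: "B r summable_on UNIV" for r
  proof -
    have "B r k = exp (2 * pi * r\<^sup>2) * exp (- (pi * c\<^sup>2) * (of_int k + x)\<^sup>2 + (4 * pi * r * c) * \<bar>of_int k + x\<bar>)" for k
    proof -
      have "(b k)\<^sup>2 = c\<^sup>2 * (of_int k + x)\<^sup>2" "\<bar>b k\<bar> = c * \<bar>of_int k + x\<bar>"
        using c by (simp_all add: b_def abs_mult power_mult_distrib)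
      then show ?thesis by (simp add: B_def add.commute mult_ac flip: exp_add)
    qed
    then show ?thesis
      using summable_on_cmult_right[OF summable_on_gaussian[of "pi * c\<^sup>2" x "4 * pi * r * c"]] c
      by (simp add: fun_eq_iff[symmetric] cong: summable_on_cong)
  qed
  have B_nonneg: "B r k \<ge> 0" for r k by (simp add: B_def)
  have le: "\<bar>hermite_kernel n (b k)\<bar> / fact n * r ^ n \<le> B r k" if "r > 0" for r n k
    using hermite_kernel_bound[OF that] by (simp add: B_def)
  show kernel_summable: "(\<lambda>k::int. (- 1) powi k * hermite_kernel n (c * (of_int k + x))) summable_on UNIV" for n
  proof (rule abs_summable_summable, rule summable_on_comparison_test[OF summable_on_cmult_right[OF B[of 1]]])
    fix k :: int
    show "norm ((- 1) powi k * hermite_kernel n (c * (of_int k + x))) \<le> fact n * B 1 k"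
      using le[of 1 n k] by (simp add: abs_mult power_int_abs b_def field_simps)
  qed auto
  \<comment> \<open>The summand $1$ keeps the radius positive at $z = 0$.\<close>
  define r where "r = 2 * norm z + 1"
  have r: "r > 0" "norm z \<le> r / 2" by (simp_all add: r_def add_nonneg_pos)
  define f where "f = (\<lambda>(k::int, n). (- 1) powi k * (of_real (hermite_kernel n (b k) / fact n) * z ^ n))"
  have f_le: "norm (f (k, n)) \<le> B r k * (1 / 2) ^ n" for k n
  proof -
    have "norm (f (k, n)) = \<bar>hermite_kernel n (b k)\<bar> / fact n * norm z ^ n"
      by (simp add: f_def norm_mult norm_power norm_divide norm_power_int)
    also have "\<dots> \<le> \<bar>hermite_kernel n (b k)\<bar> / fact n * (r / 2) ^ n"
      using r by (intro mult_left_mono power_mono) auto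
    also have "\<dots> = \<bar>hermite_kernel n (b k)\<bar> / fact n * r ^ n * (1 / 2) ^ n"
      by (simp add: power_divide)
    also have "\<dots> \<le> B r k * (1 / 2) ^ n"
      using r le by (intro mult_right_mono) auto
    finally show ?thesis .
  qed
  have geo: "((\<lambda>n. B r k * (1 / 2) ^ n) has_sum (B r k * 2)) UNIV" for k
  proof (rule has_sum_cmult_right)
    show "((\<lambda>n. (1 / 2 :: real) ^ n) has_sum 2) UNIV"
      using geometric_sums[of "1/2 :: real"] by (intro norm_summable_imp_has_sum) auto
  qed
  have "(\<lambda>(k, n). B r k * (1 / 2) ^ n) summable_on UNIV \<times> UNIV"
    by (rule summable_on_SigmaI[where g = "\<lambda>k. B r k * 2"])
       (use geo B B_nonneg in \<open>auto intro!: summable_on_cmult_left\<close>)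
  then have "(\<lambda>p. norm (f p)) summable_on UNIV \<times> UNIV"
    by (rule summable_on_comparison_test) (use f_le in auto)
  then have "f summable_on UNIV \<times> UNIV" by (rule abs_summable_summable)
  then obtain S where S: "(f has_sum S) (UNIV \<times> UNIV)" by (auto simp: summable_on_def)
  have "((\<lambda>n. f (k, n)) has_sum (- 1) powi k * hermite_gen z (b k)) UNIV" for k
  proof (rule norm_summable_imp_has_sum)
    show "summable (\<lambda>n. norm (f (k, n)))"
      by (rule summable_comparison_test'[OF summable_mult[OF summable_geometric[of "1/2 :: real"]], of 0 _ "B r k"])
         (use f_le[of k] in auto)
    show "(\<lambda>n. f (k, n)) sums ((- 1) powi k * hermite_gen z (b k))"
      unfolding f_def prod.case by (intro sums_mult hermite_gen_power_series)
  qed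
  from has_sum_SigmaD[OF S this]
  have gen: "((\<lambda>k. (- 1) powi k * hermite_gen z (b k)) has_sum S) UNIV" by simp
  then show "(\<lambda>k::int. (- 1) powi k * hermite_gen z (c * (of_int k + x))) summable_on UNIV"
    unfolding b_def summable_on_def by blast
  have swapped: "((\<lambda>(n, k). f (k, n)) has_sum S) (UNIV \<times> UNIV)"
    using S by (subst (asm) has_sum_swap)
  have "((\<lambda>k. f (k, n)) has_sum (of_real (t n / fact n) * z ^ n)) UNIV" for n
  proof -
    have "((\<lambda>k. (- 1) powi k * hermite_kernel n (b k)) has_sum t n) UNIV"
      using kernel_summable[of n] unfolding t_def b_def by (rule has_sum_infsum)
    then have "((\<lambda>k. complex_of_real ((- 1) powi k * hermite_kernel n (b k))) has_sum of_real (t n)) UNIV"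
      by (rule has_sum_of_real)
    from has_sum_cmult_left[OF this, of "z ^ n / fact n"] show ?thesis
      by (simp add: f_def field_simps)
  qed
  then have "((\<lambda>n. of_real (t n / fact n) * z ^ n) has_sum S) UNIV"
    by (intro has_sum_SigmaD[OF swapped]) simp
  then have "(\<lambda>n. of_real (t n / fact n) * z ^ n) sums S" by (rule has_sum_imp_sums)
  moreover have "S = (\<Sum>\<^sub>\<infinity>k::int. (- 1) powi k * hermite_gen z (c * (of_int k + x)))"
    using infsumI[OF gen] by (simp add: b_def)
  ultimately show "(\<lambda>n. of_real (t n / fact n) * z ^ n) sums
      (\<Sum>\<^sub>\<infinity>k::int. (- 1) powi k * hermite_gen z (c * (of_int k + x)))" by simp
qed

section \<open>Self-duality of the alternating sums for N = 2 and N = 3\<close>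

text \<open>Here $x = 1/(2N)$ is the point at which the dual series reproduces the original one. The frequency
$2l + 1$ of the dual series belongs to the nodes $\pm b_k$ when $l = Nk$ or $l = -1-Nk$, and the weight
$\cos \frac{(2l+1)\pi}{2N}$ is then $(-1)^k \cos\frac{\pi}{2N} = (-1)^k \sqrt N / 2$, an evaluation special to
$N \in \{2,3\}$. No other \<open>l\<close> contributes: for $N = 2$ there is none, and for $N = 3$ the
remaining $l \equiv 1 \pmod 3$ have weight $\cos (j\pi + \pi/2) = 0$.\<close>

lemma dual_sum_fold:
  fixes N :: nat and s :: real
  assumes N: "N \<in> {2, 3}"
  defines "x \<equiv> 1 / (2 * real N)"
  defines "b \<equiv> \<lambda>k::int. sqrt (real N) * (of_int k + x)"
  defines "u \<equiv> \<lambda>k. (- 1) powi k * exp (- (pi * (b k)\<^sup>2)) * cos (4 * pi * b k * s)"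
  defines "v \<equiv> \<lambda>l::int. exp (- (pi * (of_int l + 1 / 2)\<^sup>2 / real N)) * cos (of_int (2 * l + 1) * pi * x)
             * cos (2 * pi * of_int (2 * l + 1) * s / sqrt (real N))"
  shows "u summable_on UNIV"
    and "(v has_sum sqrt (real N) * (\<Sum>\<^sub>\<infinity>k. u k)) UNIV"
proof -
  have N0: "real N > 0" using N by auto
  have b2: "(b k)\<^sup>2 = real N * (of_int k + x)\<^sup>2" for k
    by (simp add: b_def power_mult_distrib)
  show u: "u summable_on UNIV"
  proof (rule abs_summable_summable, rule summable_on_comparison_test)
    show "(\<lambda>k::int. exp (- (pi * real N) * (of_int k + x)\<^sup>2 + 0 * \<bar>of_int k + x\<bar>)) summable_on UNIV"
      by (rule summable_on_gaussian) (use N0 in simp)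
    show "norm (u k) \<le> exp (- (pi * real N) * (of_int k + x)\<^sup>2 + 0 * \<bar>of_int k + x\<bar>)" for k
      using abs_cos_le_one[of "4 * pi * b k * s"]
      by (simp add: u_def b2 abs_mult power_int_abs mult_left_le mult.assoc)
  qed auto
  define h where "h = sqrt (real N) / 2"
  have cos_x: "cos (pi * x) = h"
    using N by (auto simp: x_def h_def cos_45 cos_30)
  have v_mult: "v (int N * k) = h * u k" for k
  proof -
    have 1: "of_int (int N * k) + 1 / 2 = real N * (of_int k + x)"
      using N0 by (simp add: x_def field_simps)
    then have 2: "of_int (2 * (int N * k) + 1) = 2 * real N * (of_int k + x)" by simp
    have "pi * (real N * (of_int k + x))\<^sup>2 / real N = pi * (b k)\<^sup>2"
      using N0 unfolding b2 by (simp add: power2_eq_square)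
    moreover have "cos (2 * real N * (of_int k + x) * pi * x) = (- 1) powi k * h"
    proof -
      have "2 * real N * (of_int k + x) * pi * x = pi * of_int k + pi * x"
        using N0 by (simp add: x_def field_simps)
      then show ?thesis
        by (simp add: cos_add cos_x power_int_minus_left)
    qed
    moreover have "2 * pi * (2 * real N * (of_int k + x)) * s / sqrt (real N) = 4 * pi * b k * s"
    proof -
      have "real N / sqrt (real N) = sqrt (real N)" using N0 by (simp add: real_div_sqrt)
      then have "4 * pi * (real N / sqrt (real N) * (of_int k + x)) * s = 4 * pi * b k * s"
        by (simp add: b_def)
      then show ?thesis by (simp add: mult_ac)
    qed
    ultimately show ?thesis unfolding v_def 1 2 by (simp add: u_def)
  qed
  have v_refl: "v (- 1 - l) = v l" for l
  proof -
    have "(of_int (- 1 - l) + 1 / 2 :: real)\<^sup>2 = (of_int l + 1 / 2)\<^sup>2"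
      by (simp add: power2_eq_square algebra_simps)
    moreover have "of_int (2 * (- 1 - l) + 1) = - (of_int (2 * l + 1) :: real)" by simp
    ultimately show ?thesis unfolding v_def by (simp only: mult_minus_left mult_minus_right minus_divide_left[symmetric] cos_minus)
  qed
  have v_zero: "v l = 0" if "l \<notin> range (\<lambda>k. int N * k)" "l \<notin> range (\<lambda>k. - 1 - int N * k)" for l
  proof -
    have nd: "\<not> int N dvd l" "\<not> int N dvd (- 1 - l)"
      using that by (auto simp: dvd_def image_iff) (metis add.commute diff_add_cancel minus_diff_eq diff_diff_eq2)
    have "N \<noteq> 2" 
    proof
      assume "N = 2"
      with nd show False by simp
    qed
    with N have N3: "N = 3" by simp
    have "l mod 3 = 1" using nd unfolding N3 of_nat_numeral by presburger
    then obtain j where l: "l = 3 * j + 1" by (metis mod_eqE mult.commute div_mult_mod_eq)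
    have "of_int (2 * l + 1) * pi * x = pi / 2 + pi * of_int j"
      by (simp add: l x_def N3 field_simps)
    then have "cos (of_int (2 * l + 1) * pi * x) = 0"
      by (simp only: cos_add cos_pi_half sin_npi_int mult_zero_left mult_zero_right diff_zero)
    then show ?thesis by (simp add: v_def)
  qed
  define U where "U = (\<Sum>\<^sub>\<infinity>k. u k)"
  have hu: "((\<lambda>k. h * u k) has_sum h * U) UNIV"
    unfolding U_def by (intro has_sum_cmult_right has_sum_infsum u)
  have "(v has_sum h * U) (range (\<lambda>k. int N * k))"
    using hu by (subst has_sum_reindex) (use N0 in \<open>auto simp: inj_on_def o_def v_mult\<close>)
  moreover have "(v has_sum h * U) (range (\<lambda>k. - 1 - int N * k))"
    using hu by (subst has_sum_reindex) (use N0 in \<open>auto simp: inj_on_def o_def v_mult v_refl\<close>)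
  moreover have "range (\<lambda>k. int N * k) \<inter> range (\<lambda>k. - 1 - int N * k) = {}"
  proof -
    have "int N * k \<noteq> - 1 - int N * j" for k j
    proof
      assume "int N * k = - 1 - int N * j"
      then have "int N * (- k - j) = 1" by (simp add: algebra_simps)
      then have "int N dvd 1" by (metis dvd_triv_left)
      then show False using N by auto
    qed
    then show ?thesis by auto
  qed
  ultimately have "(v has_sum h * U + h * U) (range (\<lambda>k. int N * k) \<union> range (\<lambda>k. - 1 - int N * k))"
    by (intro has_sum_Un_disjoint)
  then have "(v has_sum h * U + h * U) UNIV"
    by (subst has_sum_cong_neutral[where T = "range (\<lambda>k. int N * k) \<union> range (\<lambda>k. - 1 - int N * k)" and g = v])
       (use v_zero in auto)
  then show "(v has_sum sqrt (real N) * (\<Sum>\<^sub>\<infinity>k. u k)) UNIV"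
    by (simp add: h_def U_def mult.commute)
qed

text \<open>Poisson summation at the two points $x \pm 2s/\sqrt N$: the sum of the two cosines is
$2 \cos \alpha \cos \beta$, whose factor $\cos\beta$ is the even part in \<open>s\<close>, and the resulting
series folds back onto the nodes $b_k$.\<close>

lemma alternating_gaussian_even_part:
  fixes N :: nat and s :: real
  assumes N: "N \<in> {2, 3}"
  defines "x \<equiv> 1 / (2 * real N)"
  defines "b \<equiv> \<lambda>k::int. sqrt (real N) * (of_int k + x)"
  shows "(\<Sum>\<^sub>\<infinity>k. (- 1) powi k * exp (- (pi * (b k + 2 * s)\<^sup>2))) + (\<Sum>\<^sub>\<infinity>k. (- 1) powi k * exp (- (pi * (b k - 2 * s)\<^sup>2)))
     = 2 * (\<Sum>\<^sub>\<infinity>k. (- 1) powi k * exp (- (pi * (b k)\<^sup>2)) * cos (4 * pi * b k * s))"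
proof -
  have N0: "real N > 0" using N by auto
  define q where "q l = exp (- (pi * (of_int l + 1 / 2)\<^sup>2 / real N))" for l :: int
  have q: "q summable_on UNIV"
    using summable_on_gaussian[of "pi / real N" "1/2" 0] N0 by (simp add: q_def[abs_def])
  have qcos: "(\<lambda>l. q l * cos (t l)) summable_on UNIV" for t
  proof (rule abs_summable_summable, rule summable_on_comparison_test[OF q])
    show "norm (q l * cos (t l)) \<le> q l" for l
      by (simp add: abs_mult q_def mult_left_le)
  qed auto
  have sq: "pi * (b k + 2 * s)\<^sup>2 = pi * real N * (of_int k + (x + 2 * s / sqrt (real N)))\<^sup>2" for k s
  proof -
    have "b k + 2 * s = sqrt (real N) * (of_int k + (x + 2 * s / sqrt (real N)))"
      using N0 by (simp add: b_def field_simps)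
    then show ?thesis by (simp add: power_mult_distrib)
  qed
  have poisson: "(\<Sum>\<^sub>\<infinity>k. (- 1) powi k * exp (- (pi * (b k + 2 * s)\<^sup>2)))
      = (\<Sum>\<^sub>\<infinity>l. q l * cos (of_int (2 * l + 1) * pi * (x + 2 * s / sqrt (real N)))) / sqrt (real N)" for s
    unfolding sq q_def by (rule alternating_gaussian_poisson[OF N0])
  have "(\<Sum>\<^sub>\<infinity>k. (- 1) powi k * exp (- (pi * (b k + 2 * s)\<^sup>2))) + (\<Sum>\<^sub>\<infinity>k. (- 1) powi k * exp (- (pi * (b k + 2 * (- s))\<^sup>2)))
    = (\<Sum>\<^sub>\<infinity>l. q l * cos (of_int (2 * l + 1) * pi * (x + 2 * s / sqrt (real N)))
          + q l * cos (of_int (2 * l + 1) * pi * (x + 2 * (- s) / sqrt (real N)))) / sqrt (real N)"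
    unfolding poisson by (subst infsum_add[OF qcos qcos]) (simp add: add_divide_distrib)
  also have "(\<lambda>l::int. q l * cos (of_int (2 * l + 1) * pi * (x + 2 * s / sqrt (real N)))
          + q l * cos (of_int (2 * l + 1) * pi * (x + 2 * (- s) / sqrt (real N))))
     = (\<lambda>l. 2 * (q l * cos (of_int (2 * l + 1) * pi * x) * cos (2 * pi * of_int (2 * l + 1) * s / sqrt (real N))))"
  proof
    fix l :: int
    define \<alpha> \<beta> where "\<alpha> = of_int (2 * l + 1) * pi * x" and "\<beta> = 2 * pi * of_int (2 * l + 1) * s / sqrt (real N)"
    have eq: "of_int (2 * l + 1) * pi * (x + 2 * s / sqrt (real N)) = \<alpha> + \<beta>"
      "of_int (2 * l + 1) * pi * (x + 2 * (- s) / sqrt (real N)) = \<alpha> - \<beta>"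
      using N0 by (simp_all add: \<alpha>_def \<beta>_def field_simps)
    show "q l * cos (of_int (2 * l + 1) * pi * (x + 2 * s / sqrt (real N)))
          + q l * cos (of_int (2 * l + 1) * pi * (x + 2 * (- s) / sqrt (real N)))
        = 2 * (q l * cos (of_int (2 * l + 1) * pi * x) * cos (2 * pi * of_int (2 * l + 1) * s / sqrt (real N)))"
      unfolding eq \<alpha>_def[symmetric] \<beta>_def[symmetric] by (simp add: cos_add cos_diff algebra_simps)
  qed
  also have "(\<Sum>\<^sub>\<infinity>l. 2 * (q l * cos (of_int (2 * l + 1) * pi * x) * cos (2 * pi * of_int (2 * l + 1) * s / sqrt (real N))))
      = 2 * (sqrt (real N) * (\<Sum>\<^sub>\<infinity>k. (- 1) powi k * exp (- (pi * (b k)\<^sup>2)) * cos (4 * pi * b k * s)))"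
    unfolding q_def x_def b_def
    by (intro infsumI has_sum_cmult_right dual_sum_fold(2)[OF N])
  finally show ?thesis using N0 by simp
qed

lemma infsum_complex_of_real:
  "(\<Sum>\<^sub>\<infinity>k\<in>A. complex_of_real (g k)) = of_real (\<Sum>\<^sub>\<infinity>k\<in>A. g k)"
proof (cases "g summable_on A")
  case True
  then show ?thesis by (intro infsumI has_sum_of_real has_sum_infsum)
next
  case False
  moreover have "\<not> (\<lambda>k. complex_of_real (g k)) summable_on A"
    using False summable_on_Re[of "\<lambda>k. complex_of_real (g k)" A] by auto
  ultimately show ?thesis by (simp add: infsum_not_exists)
qed

text \<open>The even part of the generating function is invariant under rotation of its argument by a right
angle. This is the generating-function form of the fact that the Fourier transform multiplies
$h_n$ by $(-i)^n$: completing the square makes $\Theta(s)$ a Gaussian sum at a shifted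
point, and $\Theta(\pm i s)$ the cosine sum on the other side of the preceding identity.\<close>

lemma hermite_gen_sum_rotation:
  fixes N :: nat and s :: real
  assumes N: "N \<in> {2, 3}"
  defines "b \<equiv> \<lambda>k::int. sqrt (real N) * (of_int k + 1 / (2 * real N))"
  defines "\<Theta> \<equiv> \<lambda>z. \<Sum>\<^sub>\<infinity>k. (- 1) powi k * hermite_gen z (b k)"
  shows "\<Theta> s + \<Theta> (- s) = \<Theta> (\<i> * s) + \<Theta> (- (\<i> * s))"
proof -
  have N0: "sqrt (real N) > 0" using N by auto
  have summable: "(\<lambda>k. (- 1) powi k * hermite_gen z (b k)) summable_on UNIV" for z
    unfolding b_def by (rule hermite_sum_generating_function(2)[OF N0])
  have even: "(\<Sum>\<^sub>\<infinity>k. (- 1) powi k * exp (- (pi * (b k + 2 * s)\<^sup>2))) + (\<Sum>\<^sub>\<infinity>k. (- 1) powi k * exp (- (pi * (b k - 2 * s)\<^sup>2)))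
     = 2 * (\<Sum>\<^sub>\<infinity>k. (- 1) powi k * exp (- (pi * (b k)\<^sup>2)) * cos (4 * pi * b k * s))"
    unfolding b_def by (rule alternating_gaussian_even_part[OF N])
  have real_arg: "\<Theta> (of_real s) = of_real (exp (2 * pi * s\<^sup>2) * (\<Sum>\<^sub>\<infinity>k. (- 1) powi k * exp (- (pi * (b k + 2 * s)\<^sup>2))))" for s
  proof -
    have "hermite_gen (of_real s) (b k) = of_real (exp (2 * pi * s\<^sup>2) * exp (- (pi * (b k + 2 * s)\<^sup>2)))" for k
      by (simp add: hermite_gen_def exp_of_real[symmetric] power2_eq_square algebra_simps flip: exp_add)
    then have "\<Theta> (of_real s) = (\<Sum>\<^sub>\<infinity>k. of_real (exp (2 * pi * s\<^sup>2) * ((- 1) powi k * exp (- (pi * (b k + 2 * s)\<^sup>2)))))"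
      by (simp add: \<Theta>_def of_real_power_int mult_ac)
    then show ?thesis by (simp only: infsum_complex_of_real infsum_cmult_right')
  qed
  have "\<Theta> (\<i> * s) + \<Theta> (- (\<i> * s)) = (\<Sum>\<^sub>\<infinity>k. (- 1) powi k * hermite_gen (\<i> * s) (b k) + (- 1) powi k * hermite_gen (- (\<i> * s)) (b k))"
    unfolding \<Theta>_def by (rule infsum_add[OF summable summable, symmetric])
  also have "\<dots> = (\<Sum>\<^sub>\<infinity>k. of_real (2 * exp (2 * pi * s\<^sup>2) * ((- 1) powi k * exp (- (pi * (b k)\<^sup>2)) * cos (4 * pi * b k * s))))"
  proof (rule infsum_cong)
    fix k
    have gen: "hermite_gen z (b k) = of_real (exp (2 * pi * s\<^sup>2) * exp (- (pi * (b k)\<^sup>2))) * exp (- 4 * of_real pi * of_real (b k) * z)"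
      if "z\<^sup>2 = - (of_real s)\<^sup>2" for z
      using that by (simp add: hermite_gen_def exp_of_real[symmetric] algebra_simps flip: exp_add)
    have "exp (\<i> * of_real y) + exp (- (\<i> * of_real y)) = of_real (2 * cos y)" for y
      by (simp add: cos_of_real[symmetric] cos_exp_eq)
    from this[of "4 * pi * b k * s"]
    have "exp (- 4 * of_real pi * of_real (b k) * (\<i> * s)) + exp (- 4 * of_real pi * of_real (b k) * (- (\<i> * s)))
        = complex_of_real (2 * cos (4 * pi * b k * s))"
      by (simp add: mult_ac add.commute)
    then show "(- 1) powi k * hermite_gen (\<i> * s) (b k) + (- 1) powi k * hermite_gen (- (\<i> * s)) (b k)
        = of_real (2 * exp (2 * pi * s\<^sup>2) * ((- 1) powi k * exp (- (pi * (b k)\<^sup>2)) * cos (4 * pi * b k * s)))"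
      by (subst (1 2) gen)
         (simp_all add: power_mult_distrib of_real_power_int flip: distrib_left)
  qed
  also have "\<dots> = of_real (2 * exp (2 * pi * s\<^sup>2) * (\<Sum>\<^sub>\<infinity>k. (- 1) powi k * exp (- (pi * (b k)\<^sup>2)) * cos (4 * pi * b k * s)))"
    by (simp only: infsum_complex_of_real infsum_cmult_right')
  also have "\<dots> = of_real (exp (2 * pi * s\<^sup>2) * (2 * (\<Sum>\<^sub>\<infinity>k. (- 1) powi k * exp (- (pi * (b k)\<^sup>2)) * cos (4 * pi * b k * s))))"
    by (simp only: mult.assoc mult.left_commute)
  also have "\<dots> = \<Theta> (of_real s) + \<Theta> (of_real (- s))"
    unfolding even[symmetric] real_arg by (simp add: distrib_left)
  finally show ?thesis by simp
qed

lemma real_power_series_zero: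
  fixes a :: "nat \<Rightarrow> real"
  assumes "\<And>s. (\<lambda>n. a n * s ^ n) sums 0" "m > 0"
  shows "a m = 0"
proof (rule ccontr)
  assume "a m \<noteq> 0"
  with assms obtain e where "0 < e" "\<And>z::real. z \<in> cball 0 e - {0} \<Longrightarrow> (0::real) \<noteq> 0"
    using powser_0_nonzero[of 1 0 a "\<lambda>_. 0" m] by auto
  from this(2)[of e] this(1) show False by simp
qed

text \<open>Comparing coefficients in the rotation identity multiplies the \<open>n\<close>-th coefficient by
$1 + (-1)^n - i^n - (-i)^n$, which is $4$ for $n \equiv 2 \pmod 4$.\<close>

lemma alternating_hermite_kernel_sum_eq_0:
  fixes N n :: nat
  assumes N: "N \<in> {2, 3}" and n: "n mod 4 = 2"
  shows "(\<Sum>\<^sub>\<infinity>k::int. (- 1) powi k * hermite_kernel n (sqrt (real N) * (of_int k + 1 / (2 * real N)))) = 0"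
proof -
  have N0: "sqrt (real N) > 0" using N by auto
  define t where "t n = (\<Sum>\<^sub>\<infinity>k::int. (- 1) powi k * hermite_kernel n (sqrt (real N) * (of_int k + 1 / (2 * real N))))" for n
  define w where "w n = (1 + (- 1) ^ n - \<i> ^ n - (- \<i>) ^ n)" for n :: nat
  define \<Theta> where "\<Theta> z = (\<Sum>\<^sub>\<infinity>k::int. (- 1) powi k * hermite_gen z (sqrt (real N) * (of_int k + 1 / (2 * real N))))" for z
  have \<Theta>: "(\<lambda>n. of_real (t n / fact n) * z ^ n) sums \<Theta> z" for z
    using hermite_sum_generating_function(3)[OF N0] unfolding t_def \<Theta>_def .
  have "(\<lambda>n. t n / fact n * Re (w n) * s ^ n) sums 0" for s :: real
  proof -
    have "(\<lambda>n. of_real (t n / fact n) * of_real s ^ n + of_real (t n / fact n) * (- of_real s) ^ n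
          - (of_real (t n / fact n) * (\<i> * of_real s) ^ n + of_real (t n / fact n) * (- (\<i> * of_real s)) ^ n))
        sums (\<Theta> s + \<Theta> (- of_real s) - (\<Theta> (\<i> * s) + \<Theta> (- (\<i> * s))))"
      by (intro sums_add sums_diff \<Theta>)
    also have "\<Theta> s + \<Theta> (- of_real s) - (\<Theta> (\<i> * s) + \<Theta> (- (\<i> * s))) = 0"
      using hermite_gen_sum_rotation[OF N, of s] unfolding \<Theta>_def by simp
    also have "(\<lambda>n. of_real (t n / fact n) * of_real s ^ n + of_real (t n / fact n) * (- of_real s) ^ n
          - (of_real (t n / fact n) * (\<i> * of_real s) ^ n + of_real (t n / fact n) * (- (\<i> * of_real s)) ^ n))
        = (\<lambda>n. of_real (t n / fact n * s ^ n) * w n)"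
    proof
      fix n
      have "(- complex_of_real s) ^ n = (- 1) ^ n * of_real s ^ n"
        "(\<i> * complex_of_real s) ^ n = \<i> ^ n * of_real s ^ n"
        "(- (\<i> * complex_of_real s)) ^ n = (- \<i>) ^ n * of_real s ^ n"
        by (simp_all flip: power_mult_distrib)
      then show "of_real (t n / fact n) * of_real s ^ n + of_real (t n / fact n) * (- of_real s) ^ n
          - (of_real (t n / fact n) * (\<i> * of_real s) ^ n + of_real (t n / fact n) * (- (\<i> * of_real s)) ^ n)
        = of_real (t n / fact n * s ^ n) * w n"
        by (simp only: w_def of_real_mult of_real_power) (simp only: algebra_simps mult_1)
    qed
    finally have "(\<lambda>n. Re (of_real (t n / fact n * s ^ n) * w n)) sums Re 0"
      by (rule sums_Re)
    moreover have "Re (of_real a * v) = a * Re v" for a v by simp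
    ultimately show ?thesis by (simp only: zero_complex.sel mult_ac)
  qed
  moreover have "n > 0" using n by (cases n) auto
  ultimately have "t n / fact n * Re (w n) = 0" by (rule real_power_series_zero)
  moreover have "w n = 4"
  proof -
    have "n = 4 * (n div 4) + 2" using n by presburger
    then obtain m where "n = 4 * m + 2" by blast
    then show ?thesis by (simp add: w_def power_add power_mult)
  qed
  ultimately show ?thesis by (simp add: t_def)
qed

section \<open>Hermite functions and the Zak transform\<close>

text \<open>The generating function satisfies $G(z,-x) = G(-z,x)$; parity follows by comparing coefficients.\<close>

lemma hermite_kernel_minus: "hermite_kernel n (- x) = (- 1) ^ n * hermite_kernel n x"
proof (cases "n = 0")
  case True
  then show ?thesis by (simp add: hermite_kernel_def)
next
  case False
  define a where "a n = (hermite_kernel n (- x) - (- 1) ^ n * hermite_kernel n x) / fact n" for n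
  have "(\<lambda>n. a n * s ^ n) sums 0" for s :: real
  proof -
    have "(\<lambda>n. of_real (hermite_kernel n (- x) / fact n) * of_real s ^ n
        - of_real (hermite_kernel n x / fact n) * (- of_real s) ^ n)
      sums (hermite_gen (of_real s) (- x) - hermite_gen (- of_real s) x)"
      by (intro sums_diff hermite_gen_power_series)
    also have "hermite_gen (of_real s) (- x) - hermite_gen (- of_real s) x = of_real 0"
      by (simp add: hermite_gen_def)
    also have "(\<lambda>n. of_real (hermite_kernel n (- x) / fact n) * of_real s ^ n
        - of_real (hermite_kernel n x / fact n) * (- of_real s) ^ n) = (\<lambda>n. complex_of_real (a n * s ^ n))"
      unfolding a_def by (subst power_minus) (simp add: fun_eq_iff field_simps)
    finally show ?thesis by (simp only: sums_of_real_iff)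
  qed
  then have "a n = 0" using False by (intro real_power_series_zero) auto
  then show ?thesis by (simp add: a_def)
qed

text \<open>The substitution $k \mapsto -1-k$ reduces the nodes $p = 3$ and $p = 5$ of the theorem to $p = 1$.\<close>

lemma alternating_even_sum_reflect:
  fixes f :: "real \<Rightarrow> real"
  assumes "\<And>y. f (- y) = f y"
  shows "(\<Sum>\<^sub>\<infinity>k::int. (- 1) powi k * f (c * (of_int k + (1 - x))))
       = - (\<Sum>\<^sub>\<infinity>k::int. (- 1) powi k * f (c * (of_int k + x)))"
proof -
  have "bij (\<lambda>k::int. - 1 - k)" by (rule bij_betwI[where g = "\<lambda>k. - 1 - k"]) auto
  from infsum_reindex_bij_betw[OF this, of "\<lambda>k. (- 1) powi k * f (c * (of_int k + x))"]
  have "(\<Sum>\<^sub>\<infinity>k::int. (- 1) powi k * f (c * (of_int k + x)))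
      = (\<Sum>\<^sub>\<infinity>k::int. (- 1) powi (- 1 - k) * f (c * (of_int (- 1 - k) + x)))" by simp
  also have "\<dots> = (\<Sum>\<^sub>\<infinity>k::int. - ((- 1) powi k * f (c * (of_int k + (1 - x)))))"
  proof (rule infsum_cong)
    fix k :: int
    have "f (c * (of_int (- 1 - k) + x)) = f (c * (of_int k + (1 - x)))"
      using assms[of "c * (of_int k + (1 - x))"] by (simp add: algebra_simps)
    then show "(- 1) powi (- 1 - k) * f (c * (of_int (- 1 - k) + x)) = - ((- 1) powi k * f (c * (of_int k + (1 - x))))"
      by (simp add: power_int_minus_left)
  qed
  finally show ?thesis by (simp add: infsum_uminus)
qed

lemma zak_half:
  fixes f :: "real \<Rightarrow> real"
  shows "zak l (\<lambda>x. complex_of_real (f x)) x (1 / 2)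
       = of_real (sqrt l * (\<Sum>\<^sub>\<infinity>k::int. (- 1) powi k * f (l * (of_int k + x))))"
proof -
  have "exp (- 2 * complex_of_real pi * \<i> * of_int k * complex_of_real (1 / 2)) = of_real ((- 1) powi k)" for k
  proof -
    have "exp (- 2 * complex_of_real pi * \<i> * of_int k * complex_of_real (1 / 2)) = cis (- (pi * of_int k))"
      by (simp add: cis_conv_exp mult_ac)
    also have "\<dots> = of_real ((- 1) powi k)"
      by (simp add: complex_eq_iff power_int_minus_left)
    finally show ?thesis .
  qed
  then show ?thesis
    unfolding zak_def of_real_mult infsum_complex_of_real[symmetric]
    by (simp add: add.commute mult.commute)
qed

lemma zak_hermite_zero:
  fixes N n :: nat and x :: real
  assumes N: "N \<in> {2, 3}" and n: "n mod 4 = 2" and x: "x \<in> {1 / (2 * real N), 1 - 1 / (2 * real N)}"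
  shows "(\<lambda>k::int. (- 1) powi k * hermite_fun n (sqrt (real N) * (of_int k + x))) summable_on UNIV \<and>
      zak (sqrt (real N)) (\<lambda>x. complex_of_real (hermite_fun n x)) x (1 / 2) =
        complex_of_real (real N powr (1 / 4) *
          (\<Sum>\<^sub>\<infinity>k::int. (- 1) powi k * hermite_fun n (sqrt (real N) * (of_int k + x)))) \<and>
      real N powr (1 / 4) *
        (\<Sum>\<^sub>\<infinity>k::int. (- 1) powi k * hermite_fun n (sqrt (real N) * (of_int k + x))) = 0"
proof -
  have N0: "sqrt (real N) > 0" using N by auto
  have "even n" using n by presburger
  define C where "C = hermite_const n powr (- 1 / 2)"
  have fun_eq: "(- 1) powi k * hermite_fun n y = C * ((- 1) powi k * hermite_kernel n y)" for k y
    by (simp add: hermite_fun_def hermite_kernel_def C_def)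
  have "(\<Sum>\<^sub>\<infinity>k::int. (- 1) powi k * hermite_kernel n (sqrt (real N) * (of_int k + x))) = 0"
    using x alternating_hermite_kernel_sum_eq_0[OF N n] \<open>even n\<close>
    by (auto simp: alternating_even_sum_reflect hermite_kernel_minus)
  then have zero: "(\<Sum>\<^sub>\<infinity>k::int. (- 1) powi k * hermite_fun n (sqrt (real N) * (of_int k + x))) = 0"
    unfolding fun_eq by (simp add: infsum_cmult_right')
  have "(\<lambda>k::int. (- 1) powi k * hermite_fun n (sqrt (real N) * (of_int k + x))) summable_on UNIV"
    unfolding fun_eq by (intro summable_on_cmult_right hermite_sum_generating_function(1)[OF N0])
  moreover have "sqrt (sqrt (real N)) = real N powr (1 / 4)"
    by (simp add: powr_half_sqrt[symmetric] powr_powr)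
  ultimately show ?thesis using zero unfolding zak_half by simp
qed

theorem lemma3:
  fixes m n :: nat
  assumes "n = 4 * m + 2"
  shows "(\<forall>p \<in> {1, 3 :: real}.
      (\<lambda>k::int. (- 1) powi k * hermite_fun n (sqrt 2 * (of_int k + p / 4))) summable_on UNIV \<and>
      zak (sqrt 2) (\<lambda>x. complex_of_real (hermite_fun n x)) (p / 4) (1 / 2) =
        complex_of_real (2 powr (1 / 4) *
          (\<Sum>\<^sub>\<infinity>k::int. (- 1) powi k * hermite_fun n (sqrt 2 * (of_int k + p / 4)))) \<and>
      2 powr (1 / 4) *
        (\<Sum>\<^sub>\<infinity>k::int. (- 1) powi k * hermite_fun n (sqrt 2 * (of_int k + p / 4))) = 0)
    \<and> (\<forall>p \<in> {1, 5 :: real}.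
      (\<lambda>k::int. (- 1) powi k * hermite_fun n (sqrt 3 * (of_int k + p / 6))) summable_on UNIV \<and>
      zak (sqrt 3) (\<lambda>x. complex_of_real (hermite_fun n x)) (p / 6) (1 / 2) =
        complex_of_real (3 powr (1 / 4) *
          (\<Sum>\<^sub>\<infinity>k::int. (- 1) powi k * hermite_fun n (sqrt 3 * (of_int k + p / 6)))) \<and>
      3 powr (1 / 4) *
        (\<Sum>\<^sub>\<infinity>k::int. (- 1) powi k * hermite_fun n (sqrt 3 * (of_int k + p / 6))) = 0)"
proof -
  have n: "n mod 4 = 2" using assms by presburger
  have "p / 4 \<in> {1 / (2 * real 2), 1 - 1 / (2 * real 2)}" if "p \<in> {1, 3}" for p
    using that by auto
  moreover have "p / 6 \<in> {1 / (2 * real 3), 1 - 1 / (2 * real 3)}" if "p \<in> {1, 5}" for p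
    using that by auto
  moreover have "(2 :: nat) \<in> {2, 3}" "(3 :: nat) \<in> {2, 3}" by simp_all
  ultimately show ?thesis
    by (intro conjI[OF ballI ballI] zak_hermite_zero[where N = 2, unfolded of_nat_numeral]
        zak_hermite_zero[where N = 3, unfolded of_nat_numeral] n) simp_all
qed

end
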